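(* Let $\tau\in[0,T]$ and $\beta\in\mathbb{R}$. If $\gamma\in(0,1)$, then $$\Lambda^{\mathrm d}_\tau:ZC^{\gamma}(\Delta_\tau^3;B_\beta)\to C^{\gamma}(\Delta_\tau^2;B_\beta)$$ is linear, satisfies $\delta\Lambda^{\mathrm d}_\tau h=h$, and obeys the estimate $\|\Lambda^{\mathrm d}_\tau h\|_{\gamma,\beta;\tau}\le C_\gamma\|h\|_{\gamma,\beta;\tau}$. If $\gamma=1$, then $$\Lambda^{\mathrm d}_\tau:ZC^{1}(\Delta_\tau^3;B_\beta)\to C^{1}_{\log}(\Delta_\tau^2;B_\beta)$$ is linear, satisfies $\delta\Lambda^{\mathrm d}_\tau h=h$, and obeys the estimate $\|\Lambda^{\mathrm d}_\tau h\|_{1,\log;\tau,\beta}\le C_{1,T}\|h\|_{1,\beta;\tau}$ as well as, for every $\varepsilon\in(0,1)$, $\|\Lambda^{\mathrm d}_\tau h\|_{1-\varepsilon,\beta;\tau}\le C_{\varepsilon,T}\|h\|_{1,\beta;\tau}$. Here the constants do not depend on $\tau\in[0,T]$ or on $h$.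
   Context: Fix $T>0$ and a Banach scale $(B_\beta)_{\beta\in\mathbb{R}}$, i.e. a family of Banach spaces with continuous embeddings $B_{\beta'}\hookrightarrow B_\beta$ for $\beta\le\beta'$. For $\tau\in[0,T]$, $\Delta_\tau^n:=\{(t_1,\dots,t_n)\in[0,\tau]^n:0\le t_n\le\dots\le t_1\le\tau\}$; $C(\Delta_\tau^n;B_\beta)$ denotes continuous maps; $(\delta g)_{t_1\dots t_{n+1}}:=\sum_{i=1}^{n+1}(-1)^ig_{t_1\dots\hat t_i\dots t_{n+1}}$ (for a path, $(\delta I)_{ts}=I_t-I_s$). Norms: for $g\in C(\Delta_\tau^2;B_\beta)$, $\|g\|_{\mu,\beta;\tau}:=\sup_{0\le s<t\le\tau}\|g_{ts}\|_{B_\beta}/|t-s|^\mu$ and $\|g\|_{1,\log;\tau,\beta}:=\sup_{0\le s<t\le\tau}\frac{\|g_{ts}\|_{B_\beta}}{|t-s|(1+|\log|t-s||)}$; $C^\mu(\Delta_\tau^2;B_\beta)$ and $C^1_{\log}(\Delta_\tau^2;B_\beta)$ are the corresponding subsets of $C(\Delta_\tau^2;B_\beta)$ of finite norm. For $h\in C(\Delta_\tau^3;B_\beta)$, $\|h\|_{\mu,\beta;\tau}:=\inf\{\sum_{j=1}^m\sup_{0\le s<u<t\le\tau}\frac{\|h_{j,tus}\|_{B_\beta}}{|t-u|^{\rho_j}|u-s|^{\mu-\rho_j}}:h=\sum_{j=1}^mh_j,\ m\in\mathbb{N},\ 0<\rho_j<\mu\}$; $C^\mu(\Delta_\tau^3;B_\beta)$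 is the set where it is finite; $ZC^\mu(\Delta_\tau^3;B_\beta):=\ker(\delta)\cap C^\mu(\Delta_\tau^3;B_\beta)$. Dyadic operators: for $\gamma\in(0,1]$ let $\mathcal A^\gamma(\Delta_\tau^2;B_\beta):=\{A\in C(\Delta_\tau^2;B_\beta):\delta A\in C^\gamma(\Delta_\tau^3;B_\beta)\}$. Fix, for each $\tau$, a linear map $\mathcal I^{\mathrm d}_\tau:\mathcal A^\gamma(\Delta_\tau^2;B_\beta)\to C([0,\tau];B_\beta)$ (the normalized dyadic ordinary low-regularity sewing map, obtained from a dyadic recursion on $\bigcup_n\{k2^{-n}\tau:0\le k\le2^n\}$ and continuous extension; such maps exist) with the following properties for every $A$: $\mathcal I^{\mathrm d}_\tau(A)_0=0$; with $\mathcal R^{\mathrm d}_\tau(A):=A-\delta\mathcal I^{\mathrm d}_\tau(A)$ one has $\delta\mathcal R^{\mathrm d}_\tau(A)=\delta A$; if $\gamma\in(0,1)$, $\mathcal R^{\mathrm d}_\tau(A)\in C^\gamma(\Delta_\tau^2;B_\beta)$ with $\|\mathcal R^{\mathrm d}_\tau(A)\|_{\gamma,\beta;\tau}\le C_\gamma\|\delta A\|_{\gamma,\beta;\tau}$; if $\gamma=1$, $\mathcal R^{\mathrm d}_\tau(A)\in C^1_{\log}(\Delta_\tau^2;B_\beta)$ with $\|\mathcal R^{\mathrm d}_\tau(A)\|_{1,\log;\tau,\beta}\le C_T\|\delta A\|_{1,\beta;\tau}$ and $\|\mathcal R^{\mathrm d}_\tau(A)\|_{1-\varepsilon,\beta;\tau}\le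 C_{\varepsilon,T}\|\delta A\|_{1,\beta;\tau}$ for every $\varepsilon\in(0,1)$; the constants are independent of $\tau\in[0,T]$. For $h\in ZC^\gamma(\Delta_\tau^3;B_\beta)$ set $b^h_{ts}:=-h_{ts0}$ ($0\le s\le t\le\tau$) and $\Lambda^{\mathrm d}_\tau h:=\mathcal R^{\mathrm d}_\tau(b^h)=b^h-\delta\mathcal I^{\mathrm d}_\tau(b^h)$. *)

theory Defs
  imports "HOL-Analysis.Analysis"
begin

section \<open>Banach scales\<close>

text \<open>
  The spaces of the scale are realised as linear subspaces \<open>B \<beta>\<close> of one real vector space, each with
  its own norm \<open>N \<beta>\<close>; the embeddings are then inclusions.

  The library locale \<^locale>\<open>Metric_space\<close> wants a distance that is nonnegative and symmetric on the whole
  type, whereas a norm on \<open>V\<close> is meaningful on \<open>V\<close> only; hence the case distinction.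
\<close>

definition norm_dist :: "'v::real_vector set \<Rightarrow> ('v \<Rightarrow> real) \<Rightarrow> 'v \<Rightarrow> 'v \<Rightarrow> real" where
  "norm_dist V N x y = (if x \<in> V \<and> y \<in> V then N (x - y) else 0)"

definition norm_topology :: "'v::real_vector set \<Rightarrow> ('v \<Rightarrow> real) \<Rightarrow> 'v topology" where
  "norm_topology V N = Metric_space.mtopology V (norm_dist V N)"

locale banach_space_on =
  fixes V :: "'v::real_vector set" and N :: "'v \<Rightarrow> real"
  assumes subspace_carrier: "subspace V"
    and norm_ge_0: "x \<in> V \<Longrightarrow> 0 \<le> N x"
    and norm_eq_0: "x \<in> V \<Longrightarrow> N x = 0 \<longleftrightarrow> x = 0"
    and norm_triangle: "x \<in> V \<Longrightarrow> y \<in> V \<Longrightarrow> N (x + y) \<le> N x + N y"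
    and norm_scale: "x \<in> V \<Longrightarrow> N (a *\<^sub>R x) = \<bar>a\<bar> * N x"
    and complete: "Metric_space.mcomplete V (norm_dist V N)"

locale banach_scale =
  fixes B :: "real \<Rightarrow> 'v::real_vector set" and N :: "real \<Rightarrow> 'v \<Rightarrow> real"
  assumes banach: "banach_space_on (B \<beta>) (N \<beta>)"
    and inclusion: "\<beta> \<le> \<beta>' \<Longrightarrow> B \<beta>' \<subseteq> B \<beta>"
    and continuous_inclusion:
      "\<beta> \<le> \<beta>' \<Longrightarrow> continuous_map (norm_topology (B \<beta>') (N \<beta>')) (norm_topology (B \<beta>) (N \<beta>)) (\<lambda>x. x)"

section \<open>Simplices, continuous maps and the coboundary\<close>

text \<open>
  A point of the simplex is the list \<open>[t\<^sub>1, \<dots>, t\<^sub>n]\<close>. The topology is the Euclidean one, pulled back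
  along \<open>ts \<mapsto> (i \<mapsto> ts ! i)\<close>; the interval \<open>[0, \<tau>]\<close> is the case \<open>n = 1\<close>.
\<close>

definition ordered_simplex :: "real \<Rightarrow> nat \<Rightarrow> real list set" where
  "ordered_simplex \<tau> n = {ts. length ts = n \<and> set ts \<subseteq> {0..\<tau>} \<and> sorted_wrt (\<ge>) ts}"

definition simplex_topology :: "real \<Rightarrow> nat \<Rightarrow> real list topology" where
  "simplex_topology \<tau> n =
     pullback_topology (ordered_simplex \<tau> n) (\<lambda>ts. \<lambda>i\<in>{..<n}. ts ! i)
       (product_topology (\<lambda>_. euclideanreal) {..<n})"

text \<open>
  A map on the simplex is represented by the total function that vanishes off the simplex, so that
  equality of maps is equality of functions and the linear operations are pointwise.
\<close>

definition cont_maps ::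
    "'v::real_vector set \<Rightarrow> ('v \<Rightarrow> real) \<Rightarrow> real \<Rightarrow> nat \<Rightarrow> (real list \<Rightarrow> 'v) set" where
  "cont_maps V N \<tau> n =
     {g. continuous_map (simplex_topology \<tau> n) (norm_topology V N) g \<and>
         (\<forall>ts. ts \<notin> ordered_simplex \<tau> n \<longrightarrow> g ts = 0)}"

text \<open>
  \<open>coboundary \<tau> n\<close> maps functions of \<open>n\<close> variables to functions of \<open>n + 1\<close> variables. List positions
  start at \<open>0\<close>, so omitting the entry at position \<open>i\<close> omits \<open>t\<^bsub>i+1\<^esub>\<close> and carries the sign \<open>(-1)\<^bsup>i+1\<^esup>\<close>.
\<close>

definition coboundary ::
    "real \<Rightarrow> nat \<Rightarrow> (real list \<Rightarrow> 'v) \<Rightarrow> real list \<Rightarrow> 'v::real_vector" where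
  "coboundary \<tau> n g ts =
     (if ts \<in> ordered_simplex \<tau> (n + 1)
      then \<Sum>i<n + 1. (-1) ^ (i + 1) *\<^sub>R g (take i ts @ drop (i + 1) ts) else 0)"

definition linear_on_maps ::
    "('a \<Rightarrow> 'v::real_vector) set \<Rightarrow> (('a \<Rightarrow> 'v) \<Rightarrow> ('b \<Rightarrow> 'w::real_vector)) \<Rightarrow> bool" where
  "linear_on_maps S F \<longleftrightarrow>
     (\<forall>g\<in>S. \<forall>h\<in>S. \<forall>a b. F (\<lambda>x. a *\<^sub>R g x + b *\<^sub>R h x) = (\<lambda>y. a *\<^sub>R F g y + b *\<^sub>R F h y))"

section \<open>Norms\<close>

text \<open>
  The norms take values in \<open>[0, \<infinity>]\<close>. In particular the supremum over the empty set, which occurs for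
  \<open>\<tau> = 0\<close>, is \<open>0\<close>, and the infimum over the empty set is \<open>\<infinity>\<close>.
\<close>

definition norm2 :: "('v \<Rightarrow> real) \<Rightarrow> real \<Rightarrow> real \<Rightarrow> (real list \<Rightarrow> 'v) \<Rightarrow> ennreal" where
  "norm2 N \<tau> \<mu> g =
     (SUP (s, t)\<in>{(s, t). 0 \<le> s \<and> s < t \<and> t \<le> \<tau>}. ennreal (N (g [t, s]) / \<bar>t - s\<bar> powr \<mu>))"

definition norm2_log :: "('v \<Rightarrow> real) \<Rightarrow> real \<Rightarrow> (real list \<Rightarrow> 'v) \<Rightarrow> ennreal" where
  "norm2_log N \<tau> g =
     (SUP (s, t)\<in>{(s, t). 0 \<le> s \<and> s < t \<and> t \<le> \<tau>}.
        ennreal (N (g [t, s]) / (\<bar>t - s\<bar> * (1 + \<bar>ln \<bar>t - s\<bar>\<bar>))))"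

definition seminorm3 :: "('v \<Rightarrow> real) \<Rightarrow> real \<Rightarrow> real \<Rightarrow> real \<Rightarrow> (real list \<Rightarrow> 'v) \<Rightarrow> ennreal" where
  "seminorm3 N \<tau> \<mu> \<rho> h =
     (SUP (s, u, t)\<in>{(s, u, t). 0 \<le> s \<and> s < u \<and> u < t \<and> t \<le> \<tau>}.
        ennreal (N (h [t, u, s]) / (\<bar>t - u\<bar> powr \<rho> * \<bar>u - s\<bar> powr (\<mu> - \<rho>))))"

definition norm3 ::
    "'v::real_vector set \<Rightarrow> ('v \<Rightarrow> real) \<Rightarrow> real \<Rightarrow> real \<Rightarrow> (real list \<Rightarrow> 'v) \<Rightarrow> ennreal" where
  "norm3 V N \<tau> \<mu> h =
     Inf {\<Sum>j=1..m. seminorm3 N \<tau> \<mu> (\<rho> j) (hs j) | (m::nat) \<rho> hs.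
            1 \<le> m \<and> (\<forall>j\<in>{1..m}. hs j \<in> cont_maps V N \<tau> 3 \<and> 0 < \<rho> j \<and> \<rho> j < \<mu>) \<and>
            h = (\<lambda>ts. \<Sum>j=1..m. hs j ts)}"

definition C2 :: "'v::real_vector set \<Rightarrow> ('v \<Rightarrow> real) \<Rightarrow> real \<Rightarrow> real \<Rightarrow> (real list \<Rightarrow> 'v) set" where
  "C2 V N \<tau> \<mu> = {g \<in> cont_maps V N \<tau> 2. norm2 N \<tau> \<mu> g < \<infinity>}"

definition C2_log :: "'v::real_vector set \<Rightarrow> ('v \<Rightarrow> real) \<Rightarrow> real \<Rightarrow> (real list \<Rightarrow> 'v) set" where
  "C2_log V N \<tau> = {g \<in> cont_maps V N \<tau> 2. norm2_log N \<tau> g < \<infinity>}"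

definition C3 :: "'v::real_vector set \<Rightarrow> ('v \<Rightarrow> real) \<Rightarrow> real \<Rightarrow> real \<Rightarrow> (real list \<Rightarrow> 'v) set" where
  "C3 V N \<tau> \<mu> = {h \<in> cont_maps V N \<tau> 3. norm3 V N \<tau> \<mu> h < \<infinity>}"

definition ZC3 :: "'v::real_vector set \<Rightarrow> ('v \<Rightarrow> real) \<Rightarrow> real \<Rightarrow> real \<Rightarrow> (real list \<Rightarrow> 'v) set" where
  "ZC3 V N \<tau> \<mu> = {h \<in> C3 V N \<tau> \<mu>. coboundary \<tau> 3 h = (\<lambda>_. 0)}"

section \<open>Dyadic sewing\<close>

definition germs :: "'v::real_vector set \<Rightarrow> ('v \<Rightarrow> real) \<Rightarrow> real \<Rightarrow> real \<Rightarrow> (real list \<Rightarrow> 'v) set" where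
  "germs V N \<tau> \<gamma> = {A \<in> cont_maps V N \<tau> 2. coboundary \<tau> 2 A \<in> C3 V N \<tau> \<gamma>}"

definition remainder ::
    "real \<Rightarrow> ((real list \<Rightarrow> 'v) \<Rightarrow> (real list \<Rightarrow> 'v)) \<Rightarrow>
      (real list \<Rightarrow> 'v) \<Rightarrow> real list \<Rightarrow> 'v::real_vector" where
  "remainder \<tau> I A = (\<lambda>ts. A ts - coboundary \<tau> 1 (I A) ts)"

text \<open>
  \<open>I \<gamma> \<beta> \<tau>\<close> is the sewing map on \<open>germs (B \<beta>) (N \<beta>) \<tau> \<gamma>\<close>; it may, but need not, be the same map for
  different \<open>\<gamma>\<close> and \<open>\<beta>\<close>. The constants are \<open>Creg \<gamma> = C\<^sub>\<gamma>\<close>, \<open>Clog = C\<^sub>T\<close> and \<open>Ceps \<epsilon> = C\<^bsub>\<epsilon>,T\<^esub>\<close>.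
\<close>

locale dyadic_sewing = banach_scale B N
  for B :: "real \<Rightarrow> 'v::real_vector set" and N :: "real \<Rightarrow> 'v \<Rightarrow> real" +
  fixes T :: real
    and I :: "real \<Rightarrow> real \<Rightarrow> real \<Rightarrow> (real list \<Rightarrow> 'v) \<Rightarrow> (real list \<Rightarrow> 'v)"
    and Creg :: "real \<Rightarrow> real" and Clog :: real and Ceps :: "real \<Rightarrow> real"
  assumes T_pos: "0 < T"
    and sewing_path:
      "\<lbrakk>0 < \<gamma>; \<gamma> \<le> 1; \<tau> \<in> {0..T}\<rbrakk> \<Longrightarrow> I \<gamma> \<beta> \<tau> \<in> germs (B \<beta>) (N \<beta>) \<tau> \<gamma> \<rightarrow> cont_maps (B \<beta>) (N \<beta>) \<tau> 1"
    and sewing_linear: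
      "\<lbrakk>0 < \<gamma>; \<gamma> \<le> 1; \<tau> \<in> {0..T}\<rbrakk> \<Longrightarrow> linear_on_maps (germs (B \<beta>) (N \<beta>) \<tau> \<gamma>) (I \<gamma> \<beta> \<tau>)"
    and sewing_start:
      "\<lbrakk>0 < \<gamma>; \<gamma> \<le> 1; \<tau> \<in> {0..T}; A \<in> germs (B \<beta>) (N \<beta>) \<tau> \<gamma>\<rbrakk> \<Longrightarrow> I \<gamma> \<beta> \<tau> A [0] = 0"
    and coboundary_remainder:
      "\<lbrakk>0 < \<gamma>; \<gamma> \<le> 1; \<tau> \<in> {0..T}; A \<in> germs (B \<beta>) (N \<beta>) \<tau> \<gamma>\<rbrakk> \<Longrightarrow>
         coboundary \<tau> 2 (remainder \<tau> (I \<gamma> \<beta> \<tau>) A) = coboundary \<tau> 2 A"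
    and remainder_mem:
      "\<lbrakk>0 < \<gamma>; \<gamma> < 1; \<tau> \<in> {0..T}; A \<in> germs (B \<beta>) (N \<beta>) \<tau> \<gamma>\<rbrakk> \<Longrightarrow>
         remainder \<tau> (I \<gamma> \<beta> \<tau>) A \<in> C2 (B \<beta>) (N \<beta>) \<tau> \<gamma>"
    and remainder_bound:
      "\<lbrakk>0 < \<gamma>; \<gamma> < 1; \<tau> \<in> {0..T}; A \<in> germs (B \<beta>) (N \<beta>) \<tau> \<gamma>\<rbrakk> \<Longrightarrow>
         norm2 (N \<beta>) \<tau> \<gamma> (remainder \<tau> (I \<gamma> \<beta> \<tau>) A)
           \<le> ennreal (Creg \<gamma>) * norm3 (B \<beta>) (N \<beta>) \<tau> \<gamma> (coboundary \<tau> 2 A)"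
    and remainder_log_mem:
      "\<lbrakk>\<tau> \<in> {0..T}; A \<in> germs (B \<beta>) (N \<beta>) \<tau> 1\<rbrakk> \<Longrightarrow>
         remainder \<tau> (I 1 \<beta> \<tau>) A \<in> C2_log (B \<beta>) (N \<beta>) \<tau>"
    and remainder_log_bound:
      "\<lbrakk>\<tau> \<in> {0..T}; A \<in> germs (B \<beta>) (N \<beta>) \<tau> 1\<rbrakk> \<Longrightarrow>
         norm2_log (N \<beta>) \<tau> (remainder \<tau> (I 1 \<beta> \<tau>) A)
           \<le> ennreal Clog * norm3 (B \<beta>) (N \<beta>) \<tau> 1 (coboundary \<tau> 2 A)"
    and remainder_eps_bound:
      "\<lbrakk>\<tau> \<in> {0..T}; A \<in> germs (B \<beta>) (N \<beta>) \<tau> 1; 0 < \<epsilon>; \<epsilon> < 1\<rbrakk> \<Longrightarrow>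
         norm2 (N \<beta>) \<tau> (1 - \<epsilon>) (remainder \<tau> (I 1 \<beta> \<tau>) A)
           \<le> ennreal (Ceps \<epsilon>) * norm3 (B \<beta>) (N \<beta>) \<tau> 1 (coboundary \<tau> 2 A)"

definition base_germ :: "real \<Rightarrow> (real list \<Rightarrow> 'v) \<Rightarrow> real list \<Rightarrow> 'v::real_vector" where
  "base_germ \<tau> h = (\<lambda>ts. if ts \<in> ordered_simplex \<tau> 2 then - h (ts @ [0]) else 0)"

definition Lambda_d ::
    "real \<Rightarrow> ((real list \<Rightarrow> 'v) \<Rightarrow> (real list \<Rightarrow> 'v)) \<Rightarrow>
      (real list \<Rightarrow> 'v) \<Rightarrow> real list \<Rightarrow> 'v::real_vector" where
  "Lambda_d \<tau> I h = remainder \<tau> I (base_germ \<tau> h)"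

end

theory Submission
  imports Defs
begin

text \<open>
  Cocycles are coboundaries on the simplex because it is a cone with apex \<open>0\<close>: contracting the last
  variable of a cocycle \<open>h\<close> to \<open>0\<close> gives the germ \<open>b\<^bsub>ts\<^esub> = - h\<^bsub>ts0\<^esub>\<close>, and the cocycle identity for \<open>h\<close>
  at \<open>[t, u, s, 0]\<close> reads \<open>\<delta>b = h\<close> at \<open>[t, u, s]\<close> (\<open>coboundary_base_germ\<close>). The germ inherits continuity
  from \<open>h\<close>, so it lies in the domain of the sewing map (\<open>base_germ_in_germs\<close>). Subtracting
  from \<open>b\<close> the coboundary of a path leaves \<open>\<delta>b = h\<close> unchanged, and the remainder estimates, which
  are in terms of \<open>\<delta>b\<close>, become estimates in terms of \<open>h\<close>, with the same constants. Linearity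
  holds because \<open>h \<mapsto> b\<close> and the coboundary are linear and the sewing map is linear on germs.
\<close>

lemma topspace_simplex_topology: "topspace (simplex_topology \<tau> n) = ordered_simplex \<tau> n"
  by (auto simp: simplex_topology_def topspace_pullback_topology)

lemma append_zero_in_ordered_simplex:
  assumes "ts \<in> ordered_simplex \<tau> n" and "0 \<le> \<tau>"
  shows "ts @ [0] \<in> ordered_simplex \<tau> (Suc n)"
  using assms by (auto simp: ordered_simplex_def sorted_wrt_append)

text \<open>
  The simplex carries the initial topology of its coordinates; the coordinates of \<open>ts @ [0]\<close> are those
  of \<open>ts\<close> and a constant.
\<close>

lemma continuous_map_append_zero:
  assumes "0 \<le> \<tau>"
  shows "continuous_map (simplex_topology \<tau> n) (simplex_topology \<tau> (Suc n)) (\<lambda>ts. ts @ [0])"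
proof -
  let ?X = "simplex_topology \<tau> n"
  have "continuous_map ?X (product_topology (\<lambda>_. euclideanreal) {..<n})
          (\<lambda>ts. \<lambda>i\<in>{..<n}. ts ! i)"
    unfolding simplex_topology_def
    using continuous_map_pullback[OF continuous_map_id] by (simp add: o_def id_def)
  then have nth: "continuous_map ?X euclideanreal (\<lambda>ts. ts ! i)" if "i < n" for i
    using that by (force simp: continuous_map_componentwise)
  have "continuous_map ?X euclideanreal (\<lambda>ts. (ts @ [0]) ! i)" if "i < Suc n" for i
  proof (cases "i < n")
    case True
    have "(ts @ [0]) ! i = ts ! i" if "ts \<in> topspace ?X" for ts
      using that True
      by (simp add: topspace_simplex_topology ordered_simplex_def nth_append)
    then show ?thesis
      using continuous_map_eq[OF nth[OF True]] by metis
  next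
    case False
    with that have "i = n" by simp
    then have "(ts @ [0]) ! i = 0" if "ts \<in> topspace ?X" for ts
      using that by (auto simp: topspace_simplex_topology ordered_simplex_def)
    then show ?thesis
      using continuous_map_eq[of ?X euclideanreal "\<lambda>_. 0" "\<lambda>ts. (ts @ [0]) ! i"] by simp
  qed
  then have coords: "continuous_map ?X (product_topology (\<lambda>_. euclideanreal) {..<Suc n})
      ((\<lambda>ts. \<lambda>i\<in>{..<Suc n}. ts ! i) \<circ> (\<lambda>ts. ts @ [0]))"
    by (auto simp: continuous_map_componentwise o_def)
  show ?thesis
    unfolding simplex_topology_def[of \<tau> "Suc n"]
    by (rule continuous_map_pullback'[OF coords])
      (use assms append_zero_in_ordered_simplex topspace_simplex_topology in auto)
qed

context banach_space_on
begin

lemma norm_minus: "x \<in> V \<Longrightarrow> N (- x) = N x"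
  using norm_scale[of x "-1"] by simp

lemma metric_space_norm_dist: "Metric_space V (norm_dist V N)"
proof
  have diff: "x - y \<in> V" if "x \<in> V" "y \<in> V" for x y
    using subspace_diff[OF subspace_carrier that] .
  show "0 \<le> norm_dist V N x y" for x y
    by (simp add: norm_dist_def norm_ge_0 diff)
  show "norm_dist V N x y = norm_dist V N y x" for x y
    using norm_minus[of "x - y"] by (simp add: norm_dist_def diff)
  show "norm_dist V N x y = 0 \<longleftrightarrow> x = y" if "x \<in> V" "y \<in> V" for x y
    using that by (simp add: norm_dist_def norm_eq_0 diff)
  show "norm_dist V N x z \<le> norm_dist V N x y + norm_dist V N y z"
    if "x \<in> V" "y \<in> V" "z \<in> V" for x y z
    using that norm_triangle[of "x - y" "y - z"] by (simp add: norm_dist_def diff)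
qed

text \<open>Negation is an isometry for the distance of the norm.\<close>

lemma continuous_map_uminus: "continuous_map (norm_topology V N) (norm_topology V N) uminus"
proof -
  interpret M: Metric_space V "norm_dist V N"
    by (rule metric_space_norm_dist)
  have neg: "- x \<in> V" if "x \<in> V" for x
    using subspace_neg[OF subspace_carrier that] .
  have "norm_dist V N (- x) (- y) = norm_dist V N y x" if "x \<in> V" "y \<in> V" for x y
    using that by (simp add: norm_dist_def neg)
  then show ?thesis
    unfolding norm_topology_def M.metric_continuous_map[OF metric_space_norm_dist]
    using neg M.commute by (metis image_subsetI)
qed

lemma base_germ_in_cont_maps:
  assumes "0 \<le> \<tau>" and h: "h \<in> cont_maps V N \<tau> 3"
  shows "base_germ \<tau> h \<in> cont_maps V N \<tau> 2"
proof -
  have "continuous_map (simplex_topology \<tau> 2) (simplex_topology \<tau> 3) (\<lambda>ts. ts @ [0])"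
    using continuous_map_append_zero[OF \<open>0 \<le> \<tau>\<close>, of 2] by simp
  moreover have "continuous_map (simplex_topology \<tau> 3) (norm_topology V N) h"
    using h by (simp add: cont_maps_def)
  ultimately have "continuous_map (simplex_topology \<tau> 2) (norm_topology V N)
      (uminus \<circ> (h \<circ> (\<lambda>ts. ts @ [0])))"
    by (intro continuous_map_compose[OF _ continuous_map_uminus]) (rule continuous_map_compose)
  then have "continuous_map (simplex_topology \<tau> 2) (norm_topology V N) (base_germ \<tau> h)"
    by (rule continuous_map_eq) (simp add: base_germ_def topspace_simplex_topology)
  then show ?thesis
    by (simp add: cont_maps_def base_germ_def)
qed

end

text \<open>
  The four-term cocycle identity at \<open>[t, u, s, 0]\<close> isolates \<open>h [t, u, s]\<close>; its other three terms end
  in \<open>0\<close>, that is, they are values of the germ.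
\<close>

lemma coboundary_base_germ:
  fixes h :: "real list \<Rightarrow> 'v::real_vector"
  assumes "0 \<le> \<tau>" and zero: "\<And>ts. ts \<notin> ordered_simplex \<tau> 3 \<Longrightarrow> h ts = 0"
    and cocycle: "coboundary \<tau> 3 h = (\<lambda>_. 0)"
  shows "coboundary \<tau> 2 (base_germ \<tau> h) = h"
proof
  fix ts
  show "coboundary \<tau> 2 (base_germ \<tau> h) ts = h ts"
  proof (cases "ts \<in> ordered_simplex \<tau> 3")
    case False
    then show ?thesis by (simp add: coboundary_def zero)
  next
    case True
    then have "length ts = 3" by (simp add: ordered_simplex_def)
    then obtain t u s where ts: "ts = [t, u, s]"
      by (auto simp: numeral_3_eq_3 length_Suc_conv)
    have faces: "[u, s] \<in> ordered_simplex \<tau> 2" "[t, s] \<in> ordered_simplex \<tau> 2"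
        "[t, u] \<in> ordered_simplex \<tau> 2"
      using True by (auto simp: ts ordered_simplex_def)
    have "[t, u, s, 0] \<in> ordered_simplex \<tau> (3 + 1)"
      using append_zero_in_ordered_simplex[OF True \<open>0 \<le> \<tau>\<close>] by (simp add: ts)
    then have "coboundary \<tau> 3 h [t, u, s, 0]
        = - h [u, s, 0] + h [t, s, 0] - h [t, u, 0] + h [t, u, s]"
      unfolding coboundary_def by (simp add: lessThan_nat_numeral lessThan_Suc)
    then have "h [t, u, s] = h [u, s, 0] - h [t, s, 0] + h [t, u, 0]"
      by (simp add: cocycle algebra_simps)
    moreover have "[t, u, s] \<in> ordered_simplex \<tau> (2 + 1)"
      using True by (simp add: ts)
    then have "coboundary \<tau> 2 (base_germ \<tau> h) [t, u, s]
        = h [u, s, 0] - h [t, s, 0] + h [t, u, 0]"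
      unfolding coboundary_def using faces
      by (simp add: base_germ_def lessThan_nat_numeral lessThan_Suc)
    ultimately show ?thesis by (simp add: ts)
  qed
qed

lemma ZC3_coboundary_base_germ:
  assumes "0 \<le> \<tau>" and "h \<in> ZC3 V N \<tau> \<gamma>"
  shows "coboundary \<tau> 2 (base_germ \<tau> h) = h"
  using assms by (intro coboundary_base_germ) (auto simp: ZC3_def C3_def cont_maps_def)

lemma (in banach_space_on) base_germ_in_germs:
  assumes "0 \<le> \<tau>" and h: "h \<in> ZC3 V N \<tau> \<gamma>"
  shows "base_germ \<tau> h \<in> germs V N \<tau> \<gamma>"
proof -
  have "h \<in> C3 V N \<tau> \<gamma>" and "h \<in> cont_maps V N \<tau> 3"
    using h by (auto simp: ZC3_def C3_def)
  then show ?thesis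
    using base_germ_in_cont_maps ZC3_coboundary_base_germ[OF assms] \<open>0 \<le> \<tau>\<close>
    by (simp add: germs_def)
qed

lemma base_germ_linear:
  "base_germ \<tau> (\<lambda>ts. a *\<^sub>R g ts + b *\<^sub>R h ts) =
     (\<lambda>ts. a *\<^sub>R base_germ \<tau> g ts + b *\<^sub>R base_germ \<tau> h ts)"
  by (rule ext) (simp add: base_germ_def)

lemma coboundary_linear:
  "coboundary \<tau> n (\<lambda>ts. a *\<^sub>R g ts + b *\<^sub>R h ts) =
     (\<lambda>ts. a *\<^sub>R coboundary \<tau> n g ts + b *\<^sub>R coboundary \<tau> n h ts)"
proof -
  have sum_linear: "(\<Sum>i\<in>J. c i *\<^sub>R (a *\<^sub>R x i + b *\<^sub>R y i))
      = a *\<^sub>R (\<Sum>i\<in>J. c i *\<^sub>R x i) + b *\<^sub>R (\<Sum>i\<in>J. c i *\<^sub>R y i)"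
    for c :: "nat \<Rightarrow> real" and x y :: "nat \<Rightarrow> 'a" and J
    by (simp only: scaleR_add_right sum.distrib scaleR_sum_right scaleR_left_commute[of _ a]
        scaleR_left_commute[of _ b])
  show ?thesis
  proof
    fix ts
    show "coboundary \<tau> n (\<lambda>ts. a *\<^sub>R g ts + b *\<^sub>R h ts) ts
        = a *\<^sub>R coboundary \<tau> n g ts + b *\<^sub>R coboundary \<tau> n h ts"
      by (cases "ts \<in> ordered_simplex \<tau> (n + 1)")
        (simp_all only: coboundary_def sum_linear if_True if_False scaleR_zero_right add_0)
  qed
qed

lemma linear_on_maps_remainder:
  assumes "linear_on_maps S I"
  shows "linear_on_maps S (remainder \<tau> I)"
  using assms
  by (simp add: linear_on_maps_def remainder_def coboundary_linear scaleR_diff_right add_diff_add)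

lemma linear_on_maps_Lambda_d:
  assumes "linear_on_maps S I" and "base_germ \<tau> ` Z \<subseteq> S"
  shows "linear_on_maps Z (Lambda_d \<tau> I)"
proof -
  have "linear_on_maps S (remainder \<tau> I)"
    using assms(1) by (rule linear_on_maps_remainder)
  with assms(2) show ?thesis
    by (simp add: linear_on_maps_def Lambda_d_def base_germ_linear image_subset_iff)
qed

context dyadic_sewing
begin

lemma base_germ_sewable:
  assumes "\<tau> \<in> {0..T}" and "h \<in> ZC3 (B \<beta>) (N \<beta>) \<tau> \<gamma>"
  shows "base_germ \<tau> h \<in> germs (B \<beta>) (N \<beta>) \<tau> \<gamma>"
  using banach_space_on.base_germ_in_germs[OF banach _ assms(2)] assms(1) by simp

lemma Lambda_d_linear:
  assumes "0 < \<gamma>" "\<gamma> \<le> 1" and \<tau>: "\<tau> \<in> {0..T}"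
  shows "linear_on_maps (ZC3 (B \<beta>) (N \<beta>) \<tau> \<gamma>) (Lambda_d \<tau> (I \<gamma> \<beta> \<tau>))"
  using linear_on_maps_Lambda_d[OF sewing_linear[OF assms]] base_germ_sewable[OF \<tau>] by blast

lemma coboundary_Lambda_d:
  assumes "0 < \<gamma>" "\<gamma> \<le> 1" and \<tau>: "\<tau> \<in> {0..T}" and h: "h \<in> ZC3 (B \<beta>) (N \<beta>) \<tau> \<gamma>"
  shows "coboundary \<tau> 2 (Lambda_d \<tau> (I \<gamma> \<beta> \<tau>) h) = h"
  using coboundary_remainder[OF assms(1-3) base_germ_sewable[OF \<tau> h]]
    ZC3_coboundary_base_germ[OF _ h] \<tau>
  by (simp add: Lambda_d_def)

end

theorem proposition4p3:
  fixes Creg :: "real \<Rightarrow> real"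
    and Clog :: "real \<Rightarrow> real"
    and Ceps :: "real \<Rightarrow> real \<Rightarrow> real"
  shows "\<exists>(Kreg :: real \<Rightarrow> real) (Klog :: real \<Rightarrow> real) (Keps :: real \<Rightarrow> real \<Rightarrow> real).
    \<forall>(T :: real) (B :: real \<Rightarrow> 'v::real_vector set) (N :: real \<Rightarrow> 'v \<Rightarrow> real)
      (I :: real \<Rightarrow> real \<Rightarrow> real \<Rightarrow> (real list \<Rightarrow> 'v) \<Rightarrow> (real list \<Rightarrow> 'v)).
      dyadic_sewing B N T I Creg (Clog T) (\<lambda>\<epsilon>. Ceps \<epsilon> T) \<longrightarrow>
      (\<forall>\<tau>\<in>{0..T}. \<forall>\<beta>.
        (\<forall>\<gamma>\<in>{0<..<1}.
           Lambda_d \<tau> (I \<gamma> \<beta> \<tau>) \<in> ZC3 (B \<beta>) (N \<beta>) \<tau> \<gamma> \<rightarrow> C2 (B \<beta>) (N \<beta>) \<tau> \<gamma> \<and>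
           linear_on_maps (ZC3 (B \<beta>) (N \<beta>) \<tau> \<gamma>) (Lambda_d \<tau> (I \<gamma> \<beta> \<tau>)) \<and>
           (\<forall>h\<in>ZC3 (B \<beta>) (N \<beta>) \<tau> \<gamma>.
              coboundary \<tau> 2 (Lambda_d \<tau> (I \<gamma> \<beta> \<tau>) h) = h \<and>
              norm2 (N \<beta>) \<tau> \<gamma> (Lambda_d \<tau> (I \<gamma> \<beta> \<tau>) h)
                \<le> ennreal (Kreg \<gamma>) * norm3 (B \<beta>) (N \<beta>) \<tau> \<gamma> h)) \<and>
        (Lambda_d \<tau> (I 1 \<beta> \<tau>) \<in> ZC3 (B \<beta>) (N \<beta>) \<tau> 1 \<rightarrow> C2_log (B \<beta>) (N \<beta>) \<tau> \<and>
         linear_on_maps (ZC3 (B \<beta>) (N \<beta>) \<tau> 1) (Lambda_d \<tau> (I 1 \<beta> \<tau>)) \<and>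
         (\<forall>h\<in>ZC3 (B \<beta>) (N \<beta>) \<tau> 1.
            coboundary \<tau> 2 (Lambda_d \<tau> (I 1 \<beta> \<tau>) h) = h \<and>
            norm2_log (N \<beta>) \<tau> (Lambda_d \<tau> (I 1 \<beta> \<tau>) h)
              \<le> ennreal (Klog T) * norm3 (B \<beta>) (N \<beta>) \<tau> 1 h \<and>
            (\<forall>\<epsilon>\<in>{0<..<1}.
               norm2 (N \<beta>) \<tau> (1 - \<epsilon>) (Lambda_d \<tau> (I 1 \<beta> \<tau>) h)
                 \<le> ennreal (Keps \<epsilon> T) * norm3 (B \<beta>) (N \<beta>) \<tau> 1 h))))"
proof (rule exI[of _ Creg], rule exI[of _ Clog], rule exI[of _ Ceps],
    intro allI impI ballI conjI)
  fix T B I \<tau> \<beta>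
  fix N :: "real \<Rightarrow> 'v \<Rightarrow> real"
  assume "dyadic_sewing B N T I Creg (Clog T) (\<lambda>\<epsilon>. Ceps \<epsilon> T)" and \<tau>: "\<tau> \<in> {0..T}"
  then interpret dyadic_sewing B N T I Creg "Clog T" "\<lambda>\<epsilon>. Ceps \<epsilon> T" by simp
  note germ = base_germ_sewable[OF \<tau>, where \<beta> = \<beta>]
  have delta_germ: "coboundary \<tau> 2 (base_germ \<tau> h) = h" if "h \<in> ZC3 (B \<beta>) (N \<beta>) \<tau> \<gamma>" for h \<gamma>
    using ZC3_coboundary_base_germ[OF _ that] \<tau> by simp
  \<comment> \<open>The sewing constants themselves serve: \<open>h\<close> takes the place of \<open>\<delta>b\<close> in each estimate.\<close>
  {
    fix \<gamma> :: real assume \<gamma>: "\<gamma> \<in> {0<..<1}"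
    then show "Lambda_d \<tau> (I \<gamma> \<beta> \<tau>) \<in> ZC3 (B \<beta>) (N \<beta>) \<tau> \<gamma> \<rightarrow> C2 (B \<beta>) (N \<beta>) \<tau> \<gamma>"
      using remainder_mem \<tau> germ by (auto simp: Lambda_d_def)
    show "linear_on_maps (ZC3 (B \<beta>) (N \<beta>) \<tau> \<gamma>) (Lambda_d \<tau> (I \<gamma> \<beta> \<tau>))"
      using \<gamma> \<tau> by (intro Lambda_d_linear) auto
    fix h assume h: "h \<in> ZC3 (B \<beta>) (N \<beta>) \<tau> \<gamma>"
    show "coboundary \<tau> 2 (Lambda_d \<tau> (I \<gamma> \<beta> \<tau>) h) = h"
      using \<gamma> \<tau> h by (intro coboundary_Lambda_d) auto
    show "norm2 (N \<beta>) \<tau> \<gamma> (Lambda_d \<tau> (I \<gamma> \<beta> \<tau>) h)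
            \<le> ennreal (Creg \<gamma>) * norm3 (B \<beta>) (N \<beta>) \<tau> \<gamma> h"
      using remainder_bound[OF _ _ \<tau> germ[OF h]] \<gamma> by (simp add: Lambda_d_def delta_germ[OF h])
  }
  show "Lambda_d \<tau> (I 1 \<beta> \<tau>) \<in> ZC3 (B \<beta>) (N \<beta>) \<tau> 1 \<rightarrow> C2_log (B \<beta>) (N \<beta>) \<tau>"
    using remainder_log_mem[OF \<tau> germ] by (auto simp: Lambda_d_def)
  show "linear_on_maps (ZC3 (B \<beta>) (N \<beta>) \<tau> 1) (Lambda_d \<tau> (I 1 \<beta> \<tau>))"
    using \<tau> by (intro Lambda_d_linear) auto
  fix h assume h: "h \<in> ZC3 (B \<beta>) (N \<beta>) \<tau> 1"
  show "coboundary \<tau> 2 (Lambda_d \<tau> (I 1 \<beta> \<tau>) h) = h"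
    using \<tau> h by (intro coboundary_Lambda_d) auto
  show "norm2_log (N \<beta>) \<tau> (Lambda_d \<tau> (I 1 \<beta> \<tau>) h)
          \<le> ennreal (Clog T) * norm3 (B \<beta>) (N \<beta>) \<tau> 1 h"
    using remainder_log_bound[OF \<tau> germ[OF h]] by (simp add: Lambda_d_def delta_germ[OF h])
  fix \<epsilon> :: real assume "\<epsilon> \<in> {0<..<1}"
  then show "norm2 (N \<beta>) \<tau> (1 - \<epsilon>) (Lambda_d \<tau> (I 1 \<beta> \<tau>) h)
          \<le> ennreal (Ceps \<epsilon> T) * norm3 (B \<beta>) (N \<beta>) \<tau> 1 h"
    using remainder_eps_bound[OF \<tau> germ[OF h]] by (simp add: Lambda_d_def delta_germ[OF h])
qed

end
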